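(* Let $n$ be a positive integer and suppose $\lambda=\lambda_n$ and $\lambda_m\neq\lambda_n$ for $m=0,1,\dots,n-1$. Then the general solution of the difference equation $$\widetilde{\sigma}[x(s)]\,\Delta_{-1}\nabla_{0}y(s)+\frac{\widetilde{\tau}[x(s)]}{2}\left[\Delta_{0}y(s)+\nabla_{0}y(s)\right]+\lambda y(s)=0$$ is $$y_{n}(s)=\frac{C_{1}}{\rho(s)}\Delta_{-n}^{(n)}\Big[\rho(s)\prod_{j=0}^{n-1}\sigma(s-j)\Big]+\frac{C_{2}}{\rho(s)}\Delta_{-n}^{(n)}\left[\rho(s)\prod_{j=0}^{n-1}\sigma(s-j)\int_{N}^{s}\frac{1}{\rho(t)\prod_{j=0}^{n}\sigma(t-j)}\,d_{\nabla}x_{-n}(t)\right],$$ where $C_1,C_2$ are arbitrary constants.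
   Context: Lattice: $x(s)$ is either $x(s)=c_1q^s+c_2q^{-s}+c_3$ with $c_1c_2\neq0$ ($q\neq 0,1$, a branch of $q^s$ fixed), or $x(s)=\widetilde c_1s^2+\widetilde c_2s+\widetilde c_3$ with $\widetilde c_1\widetilde c_2\neq0$; $s$ is a complex variable. For an integer $k$ put $x_k(s)=x(s+\frac k2)$. Write $\Delta f(s)=f(s+1)-f(s)$, $\nabla f(s)=f(s)-f(s-1)$, $\Delta_kf(s)=\frac{\Delta f(s)}{\Delta x_k(s)}$, $\nabla_kf(s)=\frac{\nabla f(s)}{\nabla x_k(s)}$, and, for $n\ge1$, $\Delta_k^{(n)}=\Delta_{k+n-1}\cdots\Delta_{k+1}\Delta_k$ (so $\Delta_{-n}^{(n)}=\Delta_{-1}\Delta_{-2}\cdots\Delta_{-n}$). Equation data: $\widetilde\sigma,\widetilde\tau$ are polynomials of degree at most two and one respectively, $\lambda$ is a constant, and $$\sigma(s)=\widetilde\sigma[x(s)]-\tfrac12\widetilde\tau[x(s)]\nabla x_1(s),\qquad \tau(s)=\widetilde\tau[x(s)].$$ The function $\rho$ satisfies the Pearson type equation $\Delta_{-1}[\sigma(s)\rho(s)]=\tau(s)\rho(s)$. For a nonnegative integer $j$ let $\tau_j(s)=\dfrac{\sigma(s+j)-\sigma(s)+\tau(s+j)\nabla x_1(s+j)}{\nabla x_{j+1}(s)}$; then $\Delta_j\tau_j(s)$ is a constant independent of $s$, and for $m\ge0$ one sets $\lambda_m=-\sum_{j=0}^{m-1}\Delta_j\tau_j(s)$ (so $\lambda_0=0$).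 Discrete integral: for a function $g$ and an integer $k$, $\int_N^s g(t)\,d_\nabla x_k(t)=\sum_{t=N}^{s}g(t)\nabla x_k(t)$, the sum running over $t=N,N+1,\dots,s$ with $s\in N+\mathbb Z$, extended to all $s\in N+\mathbb Z$ so that the value at $s=N-1$ is $0$ and $\nabla_k\left[\int_N^sg(t)\,d_\nabla x_k(t)\right]=g(s)$. Solutions are considered as functions of $s\in N+\mathbb Z$. All functions appearing in denominators (such as $\rho$, $\sigma$ and the lattice differences) are assumed nonzero at the points considered. *)

theory Defs
  imports Complex_Main "HOL-Computational_Algebra.Polynomial"
begin

(* The branch of q^s is fixed by a logarithm l of q: q^s = exp (l * s). *)
definition is_lattice :: "(complex \<Rightarrow> complex) \<Rightarrow> bool" where
  "is_lattice x \<longleftrightarrow>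
     (\<exists>q l c1 c2 c3. q \<noteq> 0 \<and> q \<noteq> 1 \<and> exp l = q \<and> c1 * c2 \<noteq> 0 \<and>
        (\<forall>s. x s = c1 * exp (l * s) + c2 * exp (l * (- s)) + c3)) \<or>
     (\<exists>c1 c2 c3. c1 * c2 \<noteq> 0 \<and> (\<forall>s. x s = c1 * s\<^sup>2 + c2 * s + c3))"

definition lattice_shift :: "(complex \<Rightarrow> complex) \<Rightarrow> int \<Rightarrow> complex \<Rightarrow> complex" where
  "lattice_shift x k s = x (s + of_int k / 2)"

definition fdiff :: "(complex \<Rightarrow> complex) \<Rightarrow> complex \<Rightarrow> complex" where
  "fdiff f s = f (s + 1) - f s"

definition bdiff :: "(complex \<Rightarrow> complex) \<Rightarrow> complex \<Rightarrow> complex" where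
  "bdiff f s = f s - f (s - 1)"

definition fdivdiff :: "(complex \<Rightarrow> complex) \<Rightarrow> int \<Rightarrow> (complex \<Rightarrow> complex) \<Rightarrow> complex \<Rightarrow> complex" where
  "fdivdiff x k f s = fdiff f s / fdiff (lattice_shift x k) s"

definition bdivdiff :: "(complex \<Rightarrow> complex) \<Rightarrow> int \<Rightarrow> (complex \<Rightarrow> complex) \<Rightarrow> complex \<Rightarrow> complex" where
  "bdivdiff x k f s = bdiff f s / bdiff (lattice_shift x k) s"

(* fdivdiff_iter x k n = Delta_{k+n-1} ... Delta_{k+1} Delta_k *)
primrec fdivdiff_iter ::
    "(complex \<Rightarrow> complex) \<Rightarrow> int \<Rightarrow> nat \<Rightarrow> (complex \<Rightarrow> complex) \<Rightarrow> complex \<Rightarrow> complex" where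
  "fdivdiff_iter x k 0 f = f"
| "fdivdiff_iter x k (Suc n) f = fdivdiff x (k + int n) (fdivdiff_iter x k n f)"

definition grid :: "complex \<Rightarrow> complex set" where
  "grid N = {N + of_int i | i. True}"

definition sigma :: "(complex \<Rightarrow> complex) \<Rightarrow> complex poly \<Rightarrow> complex poly \<Rightarrow> complex \<Rightarrow> complex" where
  "sigma x st tt s = poly st (x s) - 1 / 2 * poly tt (x s) * bdiff (lattice_shift x 1) s"

definition tau :: "(complex \<Rightarrow> complex) \<Rightarrow> complex poly \<Rightarrow> complex \<Rightarrow> complex" where
  "tau x tt s = poly tt (x s)"

definition pearson_at ::
    "(complex \<Rightarrow> complex) \<Rightarrow> complex poly \<Rightarrow> complex poly \<Rightarrow> (complex \<Rightarrow> complex) \<Rightarrow> complex \<Rightarrow> bool" where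
  "pearson_at x st tt \<rho> s \<longleftrightarrow>
     fdivdiff x (- 1) (\<lambda>t. sigma x st tt t * \<rho> t) s = tau x tt s * \<rho> s"

definition tau_seq ::
    "(complex \<Rightarrow> complex) \<Rightarrow> complex poly \<Rightarrow> complex poly \<Rightarrow> nat \<Rightarrow> complex \<Rightarrow> complex" where
  "tau_seq x st tt j s =
     (sigma x st tt (s + of_nat j) - sigma x st tt s
        + tau x tt (s + of_nat j) * bdiff (lattice_shift x 1) (s + of_nat j))
     / bdiff (lattice_shift x (int j + 1)) s"

(* Every summand is independent of the point at which it is evaluated (as long as the lattice
   differences involved do not vanish), so the parameter s is only a base point. *)
definition lambda_seq ::
    "(complex \<Rightarrow> complex) \<Rightarrow> complex poly \<Rightarrow> complex poly \<Rightarrow> complex \<Rightarrow> nat \<Rightarrow> complex" where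
  "lambda_seq x st tt s m = - (\<Sum>j<m. fdivdiff x (int j) (tau_seq x st tt j) s)"

definition diff_eq_at ::
    "(complex \<Rightarrow> complex) \<Rightarrow> complex poly \<Rightarrow> complex poly \<Rightarrow> complex \<Rightarrow> (complex \<Rightarrow> complex) \<Rightarrow> complex \<Rightarrow> bool" where
  "diff_eq_at x st tt lam y s \<longleftrightarrow>
     poly st (x s) * fdivdiff x (- 1) (bdivdiff x 0 y) s
       + poly tt (x s) / 2 * (fdivdiff x 0 y s + bdivdiff x 0 y s) + lam * y s = 0"

(* For s = N + m with m an integer, m = floor (Re (s - N)).  The first sum is the integral for
   m >= 0 and is empty otherwise; the second one is its extension to m < -1 and is empty for
   m >= -1; see the two lemmas below. *)
definition nabla_integral ::
    "(complex \<Rightarrow> complex) \<Rightarrow> int \<Rightarrow> complex \<Rightarrow> (complex \<Rightarrow> complex) \<Rightarrow> complex \<Rightarrow> complex" where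
  "nabla_integral x k N g s =
     (let m = \<lfloor>Re (s - N)\<rfloor>; h = (\<lambda>i. g (N + of_int i) * bdiff (lattice_shift x k) (N + of_int i))
      in (\<Sum>i=0..m. h i) - (\<Sum>i=m+1..-1. h i))"

lemma nabla_integral_init: "nabla_integral x k N g (N - 1) = 0"
proof -
  have "\<lfloor>Re (N - 1 - N)\<rfloor> = - 1"
    by (simp add: floor_eq_iff)
  then show ?thesis
    unfolding nabla_integral_def Let_def by simp
qed

lemma bdivdiff_nabla_integral:
  assumes "s \<in> grid N" and "bdiff (lattice_shift x k) s \<noteq> 0"
  shows "bdivdiff x k (nabla_integral x k N g) s = g s"
proof -
  obtain m :: int where m: "s = N + of_int m"
    using assms(1) by (auto simp: grid_def)
  define h where "h = (\<lambda>i::int. g (N + of_int i) * bdiff (lattice_shift x k) (N + of_int i))"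
  have f1: "\<lfloor>Re (s - N)\<rfloor> = m" and f2: "\<lfloor>Re (s - 1 - N)\<rfloor> = m - 1"
    by (simp_all add: m floor_eq_iff)
  have "((\<Sum>i=0..m. h i) - (\<Sum>i=m+1..-1. h i)) - ((\<Sum>i=0..m-1. h i) - (\<Sum>i=m..-1. h i)) = h m"
  proof (cases "m \<ge> 0")
    case True
    then have "{0..m} = insert m {0..m-1}" by auto
    then show ?thesis using True by simp
  next
    case False
    then have "{m..-1} = insert m {m+1..-1}" by auto
    then show ?thesis using False by simp
  qed
  then have "bdiff (nabla_integral x k N g) s = h m"
    unfolding bdiff_def nabla_integral_def Let_def f1 f2 h_def by simp
  then show ?thesis
    using assms(2) by (simp add: bdivdiff_def h_def m)
qed

end

theory Submission
  imports Defs
begin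

text \<open>
  The difference equation is the bottom rung of a ladder. If \<open>y\<close> solves it, then its divided
  difference \<open>\<Delta>\<^sub>0 y\<close> solves an equation of the same shape on the half-shifted lattice, with
  \<open>\<tau>\<^sub>0\<close> replaced by \<open>\<tau>\<^sub>1\<close> and the eigenvalue \<open>\<lambda>\<close> by \<open>\<lambda> + \<Delta>\<^sub>0 \<tau>\<^sub>0\<close>, and so on. After \<open>n\<close> steps the
  eigenvalue is \<open>\<lambda> - \<lambda>\<^sub>n = 0\<close>, and the equation on that rung is integrated by hand: a weighted first
  difference of the solution is constant, hence the solutions are a constant plus a multiple of
  the discrete integral.

  It remains to see that all solutions on rung \<open>0\<close> arise from those on rung \<open>n\<close>. With the
  first-order operator \<open>L\<^sub>k u = \<sigma> \<nabla>\<^sub>k\<^sub>+\<^sub>1 u + \<tau>\<^sub>k u\<close> the equation on rung \<open>k\<close> reads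
  \<open>L\<^sub>k (\<Delta>\<^sub>k v) + \<mu> v = 0\<close>, and the key identity \<open>\<Delta>\<^sub>k (L\<^sub>k u) = L\<^sub>k\<^sub>+\<^sub>1 (\<Delta>\<^sub>k\<^sub>+\<^sub>1 u) + \<kappa>\<^sub>k u\<close> with
  \<open>\<kappa>\<^sub>k = \<Delta>\<^sub>k \<tau>\<^sub>k\<close> (lemma \<open>fdivdiff_lower\<close>) says that on solutions \<open>\<Delta>\<^sub>k\<close> and \<open>L\<^sub>k\<close> are inverse
  to each other up to the factor \<open>- \<mu>\<close>. So as long as \<open>\<mu> = \<lambda> - \<lambda>\<^sub>k\<close> is nonzero, \<open>L\<^sub>k\<close> maps the
  solutions on rung \<open>k + 1\<close> onto those on rung \<open>k\<close> (lemma \<open>solves_iff_lower\<close>).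

  By the Pearson equation \<open>L\<^sub>k u = \<nabla>\<^sub>k\<^sub>+\<^sub>1 (\<rho>\<^sub>k\<^sub>+\<^sub>1 u) / \<rho>\<^sub>k\<close> for suitable weights \<open>\<rho>\<^sub>k\<close>, so that the
  composition \<open>L\<^sub>0 \<dots> L\<^sub>n\<^sub>-\<^sub>1\<close> telescopes to a Rodrigues formula. The special form of
  the lattice makes \<open>\<tau>\<^sub>k\<close> an affine function of \<open>x\<^sub>k\<close> (lemma \<open>tau_seq_affine\<close>), and therefore
  \<open>\<kappa>\<^sub>k\<close> a constant.
\<close>

section \<open>Symmetry of the lattice and the functions \<open>\<tau>\<^sub>j\<close>\<close>

text \<open>
  Both kinds of lattice are treated at once through these two addition formulas: the sum of two
  symmetric lattice values is affine in the central one, and their difference is a fixed multiple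
  of the central difference. For the exponential lattice with \<open>q = exp l\<close> the coefficients are
  \<open>q\<^sup>a + q\<^sup>-\<^sup>a\<close> and \<open>(q\<^sup>a - q\<^sup>-\<^sup>a) / (q\<^sup>1\<^sup>/\<^sup>2 - q\<^sup>-\<^sup>1\<^sup>/\<^sup>2)\<close>.
\<close>

lemma lattice_symmetric:
  assumes "is_lattice x"
  obtains \<alpha> \<beta> \<gamma> where "\<And>m. x (m + a) + x (m - a) = \<alpha> * x m + \<beta>"
    and "\<And>m. x (m + a) - x (m - a) = \<gamma> * (x (m + 1/2) - x (m - 1/2))"
  using assms unfolding is_lattice_def
proof (elim disjE exE conjE)
  fix q l c1 c2 c3
  assume q: "q \<noteq> 1" "exp l = q" and x: "\<forall>s. x s = c1 * exp (l * s) + c2 * exp (l * (- s)) + c3"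
  define E where "E = exp (l * a)"
  define H where "H = exp (l * (1/2))"
  have EH: "E \<noteq> 0" "H \<noteq> 0" by (simp_all add: E_def H_def)
  have "H * H = q" unfolding H_def q(2)[symmetric] exp_add[symmetric] by simp
  \<comment> \<open>this is where \<open>q \<noteq> 1\<close> enters: \<open>H\<close> is \<open>q\<^sup>1\<^sup>/\<^sup>2\<close>\<close>
  then have H: "H - 1 / H \<noteq> 0" using q EH by (auto simp: field_simps)
  have sh: "x (m + b) = c1 * (exp (l * m) * exp (l * b)) + c2 / (exp (l * m) * exp (l * b)) + c3"
    "x (m - b) = c1 * (exp (l * m) / exp (l * b)) + c2 * (exp (l * b) / exp (l * m)) + c3" for m b
  proof -
    have "exp (l * (m + b)) = exp (l * m) * exp (l * b)" "exp (l * (- (m + b))) = 1 / (exp (l * m) * exp (l * b))"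
      "exp (l * (m - b)) = exp (l * m) / exp (l * b)" "exp (l * (- (m - b))) = exp (l * b) / exp (l * m)"
      by (simp_all add: ring_distribs exp_add exp_diff exp_minus divide_inverse)
    then show "x (m + b) = c1 * (exp (l * m) * exp (l * b)) + c2 / (exp (l * m) * exp (l * b)) + c3"
      "x (m - b) = c1 * (exp (l * m) / exp (l * b)) + c2 * (exp (l * b) / exp (l * m)) + c3"
      by (simp_all only: x[rule_format]) simp
  qed
  have x0: "x m = c1 * exp (l * m) + c2 / exp (l * m) + c3" for m
    unfolding x[rule_format] by (simp add: exp_minus divide_inverse)
  show thesis
  proof (rule that[of "E + 1 / E" "(2 - (E + 1 / E)) * c3" "(E - 1 / E) / (H - 1 / H)"])
    fix m
    show "x (m + a) + x (m - a) = (E + 1 / E) * x m + (2 - (E + 1 / E)) * c3"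
      unfolding sh E_def[symmetric] unfolding x0 using EH by (simp add: field_simps)
    have *: "c1 * (u * F) + c2 / (u * F) + c3 - (c1 * (u / F) + c2 * (F / u) + c3)
        = (F - 1 / F) * (c1 * u - c2 / u)" if "u \<noteq> 0" "F \<noteq> 0" for u F
      using that by (simp add: field_simps)
    show "x (m + a) - x (m - a) = (E - 1 / E) / (H - 1 / H) * (x (m + 1/2) - x (m - 1/2))"
      unfolding sh E_def[symmetric] H_def[symmetric]
      using *[of "exp (l * m)" E] *[of "exp (l * m)" H] EH H by simp
  qed
next
  fix c1 c2 c3
  assume x: "\<forall>s. x s = c1 * s\<^sup>2 + c2 * s + c3"
  show thesis
    by (rule that[of 2 "2 * c1 * a\<^sup>2" "2 * a"]; simp add: x power2_eq_square field_simps)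
qed

lemma poly_degree_le_1:
  fixes p :: "'a::comm_semiring_0 poly"
  assumes "degree p \<le> 1" shows "poly p z = coeff p 0 + coeff p 1 * z"
proof -
  have "p = [:coeff p 0, coeff p 1:]"
    by (rule poly_eqI) (use assms in \<open>auto simp: coeff_pCons coeff_eq_0 split: nat.split\<close>)
  then have "poly p z = poly [:coeff p 0, coeff p 1:] z" by simp
  then show ?thesis by (simp add: mult.commute)
qed

lemma poly_degree_le_2:
  fixes p :: "'a::comm_semiring_1 poly"
  assumes "degree p \<le> 2" shows "poly p z = coeff p 0 + coeff p 1 * z + coeff p 2 * z * z"
proof -
  have "p = [:coeff p 0, coeff p 1, coeff p 2:]"
    by (rule poly_eqI) (use assms in \<open>auto simp: coeff_pCons coeff_eq_0 numeral_2_eq_2 split: nat.split\<close>)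
  then have "poly p z = poly [:coeff p 0, coeff p 1, coeff p 2:] z" by simp
  then show ?thesis by (simp add: algebra_simps)
qed

text \<open>
  Around the midpoint \<open>m = s + j / 2\<close> the numerator of \<open>\<tau>\<^sub>j\<close> is odd under reflection: it is a combination of
  \<open>P - P'\<close> and \<open>E + E'\<close>, which are multiples of the central difference, with coefficients built from
  \<open>P + P'\<close> and \<open>E - E'\<close>, which are affine in \<open>x m = x\<^sub>j s\<close>. Here \<open>P\<close>, \<open>P'\<close> are the values of \<open>x\<close> and
  \<open>E\<close>, \<open>E'\<close> the lattice steps at \<open>m + j / 2\<close> and \<open>m - j / 2\<close>.
\<close>
lemma tau_seq_affine:
  assumes "is_lattice x" "degree st \<le> 2" "degree tt \<le> 1"
  obtains A B where "\<And>s. bdiff (lattice_shift x (int j + 1)) s \<noteq> 0 \<Longrightarrow>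
    tau_seq x st tt j s = A * lattice_shift x (int j) s + B"
proof -
  define a :: complex where "a = of_nat j / 2"
  obtain \<alpha> \<beta> \<gamma> where 0: "\<And>m. x (m + a) + x (m - a) = \<alpha> * x m + \<beta>"
    "\<And>m. x (m + a) - x (m - a) = \<gamma> * (x (m + 1/2) - x (m - 1/2))"
    using lattice_symmetric[OF assms(1)] by metis
  obtain \<alpha>1 \<beta>1 \<gamma>1 where 1: "\<And>m. x (m + (a + 1/2)) + x (m - (a + 1/2)) = \<alpha>1 * x m + \<beta>1"
    "\<And>m. x (m + (a + 1/2)) - x (m - (a + 1/2)) = \<gamma>1 * (x (m + 1/2) - x (m - 1/2))"
    using lattice_symmetric[OF assms(1)] by metis
  obtain \<alpha>2 \<beta>2 \<gamma>2 where 2: "\<And>m. x (m + (a - 1/2)) + x (m - (a - 1/2)) = \<alpha>2 * x m + \<beta>2"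
    "\<And>m. x (m + (a - 1/2)) - x (m - (a - 1/2)) = \<gamma>2 * (x (m + 1/2) - x (m - 1/2))"
    using lattice_symmetric[OF assms(1)] by metis
  define p1 p2 t0 t1 where "p1 = coeff st 1" "p2 = coeff st 2" "t0 = coeff tt 0" "t1 = coeff tt 1"
  show thesis
  proof (rule that[of "p2 * \<gamma> * \<alpha> + t1 / 4 * (\<alpha> * (\<gamma>1 - \<gamma>2) + \<gamma> * (\<alpha>1 - \<alpha>2))"
      "p1 * \<gamma> + p2 * \<gamma> * \<beta> + t0 / 2 * (\<gamma>1 - \<gamma>2) + t1 / 4 * (\<beta> * (\<gamma>1 - \<gamma>2) + \<gamma> * (\<beta>1 - \<beta>2))"])
    fix s
    assume nz: "bdiff (lattice_shift x (int j + 1)) s \<noteq> 0"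
    define m where "m = s + a"
    define P P' D where "P = x (m + a)" "P' = x (m - a)" "D = x (m + 1/2) - x (m - 1/2)"
    define E E' where "E = x (m + a + 1/2) - x (m + a - 1/2)" "E' = x (m - a + 1/2) - x (m - a - 1/2)"
    note defs = P_P'_D_def E_E'_def
    have sD: "bdiff (lattice_shift x (int j + 1)) s = D"
    proof -
      have "s + of_int (int j + 1) / 2 = m + 1 / 2" "s - 1 + of_int (int j + 1) / 2 = m - 1 / 2"
        by (simp_all add: m_def a_def field_simps)
      then show ?thesis by (simp add: bdiff_def lattice_shift_def defs)
    qed
    have sP: "x (s + of_nat j) = P" "x s = P'"
      by (simp_all add: defs m_def a_def add.assoc)
    have sE: "bdiff (lattice_shift x 1) (s + of_nat j) = E" "bdiff (lattice_shift x 1) s = E'"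
    proof -
      have "s + of_nat j + of_int 1 / 2 = m + a + 1 / 2" "s + of_nat j - 1 + of_int 1 / 2 = m + a - 1 / 2"
        "s + of_int 1 / 2 = m - a + 1 / 2" "s - 1 + of_int 1 / 2 = m - a - 1 / 2"
        by (simp_all add: m_def a_def field_simps)
      then show "bdiff (lattice_shift x 1) (s + of_nat j) = E" "bdiff (lattice_shift x 1) s = E'"
        by (simp_all only: bdiff_def lattice_shift_def defs)
    qed
    have sm: "lattice_shift x (int j) s = x m"
      by (simp add: lattice_shift_def m_def a_def)
    have PP: "P + P' = \<alpha> * x m + \<beta>" "P - P' = \<gamma> * D"
      using 0[of m] by (simp_all add: defs)
    have EE: "E + E' = (\<gamma>1 - \<gamma>2) * D" "E - E' = (\<alpha>1 - \<alpha>2) * x m + (\<beta>1 - \<beta>2)"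
      using 1[of m] 2[of m] by (simp_all add: defs algebra_simps)
    have "sigma x st tt (s + of_nat j) - sigma x st tt s
        + tau x tt (s + of_nat j) * bdiff (lattice_shift x 1) (s + of_nat j)
        = (P - P') * (p1 + p2 * (P + P')) + t0 / 2 * (E + E')
          + t1 / 4 * ((P + P') * (E + E') + (P - P') * (E - E'))"
      unfolding sigma_def tau_def sP sE poly_degree_le_2[OF assms(2)] poly_degree_le_1[OF assms(3)]
        p1_p2_t0_t1_def
      by (simp add: field_simps)
    also have "\<dots> = D * ((p2 * \<gamma> * \<alpha> + t1 / 4 * (\<alpha> * (\<gamma>1 - \<gamma>2) + \<gamma> * (\<alpha>1 - \<alpha>2))) * x m +
      (p1 * \<gamma> + p2 * \<gamma> * \<beta> + t0 / 2 * (\<gamma>1 - \<gamma>2) + t1 / 4 * (\<beta> * (\<gamma>1 - \<gamma>2) + \<gamma> * (\<beta>1 - \<beta>2))))"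
      unfolding PP EE by (simp add: field_simps)
    finally show "tau_seq x st tt j s = (p2 * \<gamma> * \<alpha> + t1 / 4 * (\<alpha> * (\<gamma>1 - \<gamma>2) + \<gamma> * (\<alpha>1 - \<alpha>2))) * lattice_shift x (int j) s +
      (p1 * \<gamma> + p2 * \<gamma> * \<beta> + t0 / 2 * (\<gamma>1 - \<gamma>2) + t1 / 4 * (\<beta> * (\<gamma>1 - \<gamma>2) + \<gamma> * (\<beta>1 - \<beta>2)))"
      using nz unfolding tau_seq_def sD sm by simp
  qed
qed

section \<open>Divided differences on the grid\<close>

lemma grid_of_int: "N + of_int i \<in> grid N"
  unfolding grid_def by blast

lemma grid_shift [simp]:
  "s \<in> grid N \<Longrightarrow> s + 1 \<in> grid N" "s \<in> grid N \<Longrightarrow> s - 1 \<in> grid N"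
  "s \<in> grid N \<Longrightarrow> s + of_nat k \<in> grid N" "s \<in> grid N \<Longrightarrow> s - of_nat k \<in> grid N"
proof -
  have shift: "s + of_int i \<in> grid N" if "s \<in> grid N" for s i
    using that unfolding grid_def by (auto simp: add.assoc simp flip: of_int_add)
  show "s \<in> grid N \<Longrightarrow> s + 1 \<in> grid N" "s \<in> grid N \<Longrightarrow> s - 1 \<in> grid N"
    "s \<in> grid N \<Longrightarrow> s + of_nat k \<in> grid N" "s \<in> grid N \<Longrightarrow> s - of_nat k \<in> grid N"
    using shift[of s 1] shift[of s "- 1"] shift[of s "int k"] shift[of s "- int k"] by simp_all
qed

lemma grid_shift' [simp]: "s \<in> grid N \<Longrightarrow> 1 + s \<in> grid N"
  using grid_shift(1)[of s N] by (simp add: add.commute)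

lemma grid_base [simp]: "N \<in> grid N"
  using grid_of_int[of N 0] by simp

lemma grid_constant:
  assumes "\<And>s. s \<in> grid N \<Longrightarrow> f (s + 1) = f s" "s \<in> grid N"
  shows "f s = f N"
proof -
  obtain i where "s = N + of_int i" using assms(2) by (auto simp: grid_def)
  moreover have "f (N + of_int i) = f N"
  proof (induction i rule: int_induct[of _ 0])
    case (step1 i)
    then show ?case using assms(1)[of "N + of_int i"] by (simp add: grid_of_int add.assoc)
  next
    case (step2 i)
    then show ?case using assms(1)[of "N + of_int (i - 1)"] grid_of_int[of N "i - 1"] by simp
  qed simp
  ultimately show ?thesis by simp
qed

lemma fdiff_lattice_shift: "fdiff (lattice_shift x k) s = bdiff (lattice_shift x (k + 2)) s"
proof -
  have "s + 1 + of_int k / 2 = s + of_int (k + 2) / 2" "s + of_int k / 2 = s - 1 + of_int (k + 2) / 2"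
    by (simp_all add: field_simps)
  then show ?thesis by (simp only: fdiff_def bdiff_def lattice_shift_def)
qed

lemma bdiff_lattice_shift_add_nat:
  "bdiff (lattice_shift x k) (s + of_nat j) = bdiff (lattice_shift x (k + 2 * int j)) s"
proof -
  have "s + of_nat j + of_int k / 2 = s + of_int (k + 2 * int j) / 2"
    "s + of_nat j - 1 + of_int k / 2 = s - 1 + of_int (k + 2 * int j) / 2"
    by (simp_all add: field_simps)
  then show ?thesis by (simp only: bdiff_def lattice_shift_def)
qed

text \<open>
  Translates the forward differences with negative lattice index of the Rodrigues formula into
  the backward differences that occur in the ladder.
\<close>
lemma fdivdiff_shift:
  "fdivdiff x (- int k - 1) (\<lambda>t. f (t - of_nat (Suc k))) s = bdivdiff x (int k + 1) f (s - of_nat k)"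
  using bdiff_lattice_shift_add_nat[of x "1 - int k" "s - of_nat k" k]
  by (simp add: fdivdiff_def bdivdiff_def fdiff_lattice_shift, simp add: fdiff_def bdiff_def algebra_simps)

lemma fdivdiff_iter_Suc_right:
  "fdivdiff_iter x k (Suc n) f = fdivdiff_iter x (k + 1) n (fdivdiff x k f)"
  by (induction n) (simp_all add: algebra_simps)

lemma fdivdiff_iter_cong:
  assumes "\<And>s. s \<in> grid N \<Longrightarrow> f s = g s" "s \<in> grid N"
  shows "fdivdiff_iter x k n f s = fdivdiff_iter x k n g s"
  using assms(2) by (induction n arbitrary: s) (simp_all add: assms(1) fdivdiff_def fdiff_def)

lemma fdivdiff_iter_linear:
  "fdivdiff_iter x k n (\<lambda>t. a * f t + b * g t) s = a * fdivdiff_iter x k n f s + b * fdivdiff_iter x k n g s"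
proof (induction n arbitrary: s)
  case (Suc n)
  have "fdiff (fdivdiff_iter x k n (\<lambda>t. a * f t + b * g t)) s
     = a * fdiff (fdivdiff_iter x k n f) s + b * fdiff (fdivdiff_iter x k n g) s"
    by (simp add: fdiff_def Suc algebra_simps)
  then show ?case by (simp add: fdivdiff_def add_divide_distrib)
qed simp

section \<open>The ladder of difference equations\<close>

locale hypergeometric_grid =
  fixes x \<rho> :: "complex \<Rightarrow> complex" and st tt :: "complex poly" and N :: complex
  assumes lattice: "is_lattice x"
    and deg_st: "degree st \<le> 2" and deg_tt: "degree tt \<le> 1"
    and lattice_nz: "\<And>k s. s \<in> grid N \<Longrightarrow> bdiff (lattice_shift x k) s \<noteq> 0"
    and sigma_nz: "\<And>s. s \<in> grid N \<Longrightarrow> sigma x st tt s \<noteq> 0"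
    and rho_nz: "\<And>s. s \<in> grid N \<Longrightarrow> \<rho> s \<noteq> 0"
    and pearson: "\<And>s. s \<in> grid N \<Longrightarrow> pearson_at x st tt \<rho> s"
begin

abbreviation \<sigma> :: "complex \<Rightarrow> complex" where "\<sigma> \<equiv> sigma x st tt"

abbreviation \<tau> :: "nat \<Rightarrow> complex \<Rightarrow> complex" where "\<tau> \<equiv> tau_seq x st tt"

abbreviation step :: "int \<Rightarrow> complex \<Rightarrow> complex" where "step k \<equiv> bdiff (lattice_shift x k)"

text \<open>
  The difference \<open>\<lambda>\<^sub>k - \<lambda>\<^sub>k\<^sub>+\<^sub>1\<close> of consecutive eigenvalues, read off at the base point of the grid.
\<close>
definition \<kappa> :: "nat \<Rightarrow> complex" where "\<kappa> k = fdivdiff x (int k) (\<tau> k) N"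

text \<open>
  The operator \<open>L\<^sub>k\<close>; it leads one rung down, from rung \<open>k + 1\<close> to rung \<open>k\<close>.
\<close>
definition lower :: "nat \<Rightarrow> (complex \<Rightarrow> complex) \<Rightarrow> complex \<Rightarrow> complex" where
  "lower k u s = \<sigma> s * bdivdiff x (int k + 1) u s + \<tau> k s * u s"

text \<open>
  As \<open>\<nabla>\<^sub>k\<^sub>+\<^sub>1 (\<Delta>\<^sub>k v) = \<Delta>\<^sub>k\<^sub>-\<^sub>1 (\<nabla>\<^sub>k v)\<close>, this is the usual equation
  \<open>\<sigma> \<Delta>\<^sub>k\<^sub>-\<^sub>1 \<nabla>\<^sub>k v + \<tau>\<^sub>k \<Delta>\<^sub>k v + \<mu> v = 0\<close> of hypergeometric type.
\<close>
definition solves :: "nat \<Rightarrow> complex \<Rightarrow> (complex \<Rightarrow> complex) \<Rightarrow> bool" where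
  "solves k \<mu> v \<longleftrightarrow> (\<forall>s\<in>grid N. lower k (fdivdiff x (int k) v) s + \<mu> * v s = 0)"

text \<open>
  The weight \<open>\<rho>\<^sub>k\<close> that makes the equation on rung \<open>k\<close> self-adjoint.
\<close>
definition weight :: "nat \<Rightarrow> complex \<Rightarrow> complex" where
  "weight k s = \<rho> (s + of_nat k) * (\<Prod>j<k. \<sigma> (s + of_nat k - of_nat j))"

lemma fdivdiff_tau_seq:
  assumes "s \<in> grid N"
  shows "fdivdiff x (int k) (\<tau> k) s = \<kappa> k"
proof -
  obtain A B where AB: "\<And>s. bdiff (lattice_shift x (int k + 1)) s \<noteq> 0 \<Longrightarrow>
    tau_seq x st tt k s = A * lattice_shift x (int k) s + B"
    using tau_seq_affine[OF lattice deg_st deg_tt] by metis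
  have "fdivdiff x (int k) (\<tau> k) s = A" if s: "s \<in> grid N" for s
  proof -
    have "fdiff (\<tau> k) s = A * fdiff (lattice_shift x (int k)) s"
      using s by (simp add: fdiff_def AB lattice_nz algebra_simps)
    moreover have "fdiff (lattice_shift x (int k)) s \<noteq> 0"
      using s by (simp add: fdiff_lattice_shift lattice_nz)
    ultimately show ?thesis by (simp add: fdivdiff_def)
  qed
  then show ?thesis using assms by (simp add: \<kappa>_def)
qed

lemma tau_seq_times_step:
  assumes "s \<in> grid N"
  shows "\<tau> k s * step (int k + 1) s
    = \<sigma> (s + of_nat k) - \<sigma> s + tau x tt (s + of_nat k) * step 1 (s + of_nat k)"
  using lattice_nz[OF assms] by (simp add: tau_seq_def)

text \<open>
  The definition of \<open>\<tau>\<^sub>j\<close> telescopes; this recursion is what one gets by collecting the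
  coefficients of \<open>\<Delta>\<^sub>k\<^sub>+\<^sub>1 u\<close> when \<open>\<Delta>\<^sub>k\<close> is applied to \<open>L\<^sub>k u\<close>.
\<close>
lemma tau_seq_Suc:
  assumes "s \<in> grid N"
  shows "\<tau> (Suc k) s * step (int k + 2) s = \<sigma> (s + 1) - \<sigma> s + \<tau> k (s + 1) * step (int k + 3) s"
proof -
  have e: "step (int k + 1) (s + 1) = step (int k + 3) s"
    using bdiff_lattice_shift_add_nat[of x "int k + 1" s 1] by (simp add: add.assoc)
  have i: "int (Suc k) + 1 = int k + 2" "s + of_nat (Suc k) = s + 1 + of_nat k"
    by simp_all
  show ?thesis
    using tau_seq_times_step[OF assms, of "Suc k"] tau_seq_times_step[OF grid_shift(1)[OF assms], of k]
    unfolding i e by simp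
qed

text \<open>
  The identity behind the ladder. It is the product rule applied to both terms of \<open>L\<^sub>k u\<close>: the
  first gives \<open>\<sigma> \<Delta>\<^sub>k \<nabla>\<^sub>k\<^sub>+\<^sub>1 u + (\<Delta>\<^sub>k \<sigma>) \<Delta>\<^sub>k\<^sub>+\<^sub>1 u\<close>, the second contributes \<open>\<kappa>\<^sub>k u\<close> and a further
  multiple of \<open>\<Delta>\<^sub>k\<^sub>+\<^sub>1 u\<close>, and the coefficients of \<open>\<Delta>\<^sub>k\<^sub>+\<^sub>1 u\<close> add up to \<open>\<tau>\<^sub>k\<^sub>+\<^sub>1\<close>.
\<close>
lemma fdivdiff_lower:
  assumes s: "s \<in> grid N"
  shows "fdivdiff x (int k) (lower k u) s
    = lower (Suc k) (fdivdiff x (int (Suc k)) u) s + \<kappa> k * u s"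
proof -
  define a b c where "a = step (int k + 1) s" "b = step (int k + 2) s" "c = step (int k + 3) s"
  note abc = a_b_c_def
  have nz: "a \<noteq> 0" "b \<noteq> 0" "c \<noteq> 0" using lattice_nz[OF s] by (simp_all add: abc)
  have c: "step (int k + 1) (s + 1) = c"
    using bdiff_lattice_shift_add_nat[of x "int k + 1" s 1] by (simp add: abc add_ac)
  have a: "step (int k + 3) (s - 1) = a"
    using bdiff_lattice_shift_add_nat[of x "int k + 1" "s - 1" 1] by (simp add: abc add_ac)
  have t1: "\<tau> (Suc k) s = (\<sigma> (s + 1) - \<sigma> s + \<tau> k (s + 1) * c) / b"
    using tau_seq_Suc[OF s, of k] nz by (simp add: abc field_simps)
  have t: "\<tau> k (s + 1) = \<tau> k s + \<kappa> k * b"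
    using fdivdiff_tau_seq[OF s, of k] nz
    by (simp add: fdivdiff_def fdiff_lattice_shift abc field_simps fdiff_def[of "\<tau> k"])
  have L: "fdivdiff x (int k) (lower k u) s = (\<sigma> (s + 1) * ((u (s + 1) - u s) / c) + \<tau> k (s + 1) * u (s + 1)
     - (\<sigma> s * ((u s - u (s - 1)) / a) + \<tau> k s * u s)) / b"
    by (simp add: fdivdiff_def fdiff_lattice_shift abc[symmetric] c,
        simp add: fdiff_def lower_def bdivdiff_def bdiff_def[of u] c abc[symmetric])
  have R: "lower (Suc k) (fdivdiff x (int (Suc k)) u) s =
     \<sigma> s * (((u (s + 1) - u s) / c - (u s - u (s - 1)) / a) / b) + \<tau> (Suc k) s * ((u (s + 1) - u s) / c)"
    by (simp add: lower_def bdivdiff_def bdiff_def[of "fdivdiff _ _ _"] fdivdiff_def fdiff_lattice_shift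
        fdiff_def[of u] add_ac a abc[symmetric])
  show ?thesis unfolding L R t1 t using nz by (simp add: field_simps)
qed

lemma lower_cong:
  assumes "\<And>s. s \<in> grid N \<Longrightarrow> u s = u' s" "s \<in> grid N"
  shows "lower k u s = lower k u' s"
  using assms by (simp add: lower_def bdivdiff_def bdiff_def[of u] bdiff_def[of u'])

lemma lower_scale: "lower k (\<lambda>t. a * u t) s = a * lower k u s"
proof -
  have "bdiff (\<lambda>t. a * u t) s = a * bdiff u s"
    by (simp add: bdiff_def right_diff_distrib)
  then show ?thesis by (simp add: lower_def bdivdiff_def distrib_left mult.left_commute)
qed

lemma fdivdiff_cong:
  assumes "\<And>s. s \<in> grid N \<Longrightarrow> u s = u' s" "s \<in> grid N"
  shows "fdivdiff x k u s = fdivdiff x k u' s"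
  using assms by (simp add: fdivdiff_def fdiff_def[of u] fdiff_def[of u'])

text \<open>
  Upwards, \<open>u = - \<Delta>\<^sub>k v / \<mu>\<close> is the preimage, because the equation for \<open>v\<close> says that \<open>L\<^sub>k u = v\<close>.
  Downwards, the identity above turns the equation for \<open>u\<close> into \<open>\<Delta>\<^sub>k (L\<^sub>k u) = - \<mu> u\<close>, and applying
  \<open>L\<^sub>k\<close> once more gives the equation for \<open>v = L\<^sub>k u\<close>.
\<close>
lemma solves_iff_lower:
  assumes "\<mu> \<noteq> 0"
  shows "solves k \<mu> v \<longleftrightarrow> (\<exists>u. solves (Suc k) (\<mu> + \<kappa> k) u \<and> (\<forall>s\<in>grid N. v s = lower k u s))"
proof
  assume v: "solves k \<mu> v"
  define u where "u = (\<lambda>s. - 1 / \<mu> * fdivdiff x (int k) v s)"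
  have vu: "v s = lower k u s" if "s \<in> grid N" for s
    using v that assms unfolding u_def lower_scale solves_def
    by (simp add: field_simps add_eq_0_iff)
  have "lower (Suc k) (fdivdiff x (int (Suc k)) u) s + (\<mu> + \<kappa> k) * u s = 0" if s: "s \<in> grid N" for s
  proof -
    have "fdivdiff x (int k) v s = fdivdiff x (int k) (lower k u) s"
      using vu s by (rule fdivdiff_cong)
    moreover have "fdivdiff x (int k) v s = - \<mu> * u s" using assms by (simp add: u_def)
    ultimately have "- \<mu> * u s = lower (Suc k) (fdivdiff x (int (Suc k)) u) s + \<kappa> k * u s"
      by (simp only: fdivdiff_lower[OF s])
    from arg_cong[OF this, of "\<lambda>z. z + \<mu> * u s"] show ?thesis by (simp add: distrib_right add_ac)
  qed
  then show "\<exists>u. solves (Suc k) (\<mu> + \<kappa> k) u \<and> (\<forall>s\<in>grid N. v s = lower k u s)"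
    using vu by (auto simp: solves_def)
next
  assume "\<exists>u. solves (Suc k) (\<mu> + \<kappa> k) u \<and> (\<forall>s\<in>grid N. v s = lower k u s)"
  then obtain u where u: "solves (Suc k) (\<mu> + \<kappa> k) u" and vu: "\<And>s. s \<in> grid N \<Longrightarrow> v s = lower k u s"
    by blast
  have D: "fdivdiff x (int k) v s = - \<mu> * u s" if s: "s \<in> grid N" for s
  proof -
    have "fdivdiff x (int k) v s = fdivdiff x (int k) (lower k u) s"
      using vu s by (rule fdivdiff_cong)
    moreover have "lower (Suc k) (fdivdiff x (int (Suc k)) u) s + (\<mu> + \<kappa> k) * u s = 0"
      using u s unfolding solves_def by blast
    ultimately show ?thesis unfolding fdivdiff_lower[OF s] by (simp add: algebra_simps add_eq_0_iff)
  qed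
  have "lower k (fdivdiff x (int k) v) s = - \<mu> * lower k u s" if "s \<in> grid N" for s
    using lower_cong[OF D that] lower_scale[of k "- \<mu>" u s] by simp
  then show "solves k \<mu> v" by (simp add: solves_def vu)
qed

text \<open>
  The term \<open>- \<tau> \<nabla>x\<^sub>1 / 2\<close> in \<open>\<sigma>\<close> trades the mean of \<open>\<Delta>\<^sub>0 y\<close> and \<open>\<nabla>\<^sub>0 y\<close> for \<open>\<Delta>\<^sub>0 y\<close>, since
  \<open>\<Delta>\<^sub>0 y - \<nabla>\<^sub>0 y = \<nabla>x\<^sub>1 \<Delta>\<^sub>-\<^sub>1 \<nabla>\<^sub>0 y\<close>.
\<close>
lemma diff_eq_iff_solves:
  "(\<forall>s\<in>grid N. diff_eq_at x st tt \<mu> y s) \<longleftrightarrow> solves 0 \<mu> y"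
proof -
  have "poly st (x s) * fdivdiff x (- 1) (bdivdiff x 0 y) s
       + poly tt (x s) / 2 * (fdivdiff x 0 y s + bdivdiff x 0 y s) = lower 0 (fdivdiff x 0 y) s"
    if s: "s \<in> grid N" for s
  proof -
    define a where "a = step 1 s"
    have nz: "a \<noteq> 0" using lattice_nz[OF s] by (simp add: a_def)
    have b: "bdivdiff x 0 y t = fdivdiff x 0 y (t - 1)" for t
      using bdiff_lattice_shift_add_nat[of x 0 "t - 1" 1]
      by (simp add: bdivdiff_def fdivdiff_def fdiff_lattice_shift, simp add: fdiff_def bdiff_def)
    have A: "fdivdiff x (- 1) (bdivdiff x 0 y) s = (fdivdiff x 0 y s - fdivdiff x 0 y (s - 1)) / a"
      by (simp add: fdivdiff_def[of x "- 1"] fdiff_lattice_shift a_def, simp add: fdiff_def[of "bdivdiff _ _ _"] b)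
    have t: "\<tau> 0 s = poly tt (x s)"
      using nz by (simp add: tau_seq_def tau_def a_def)
    have L: "lower 0 (fdivdiff x 0 y) s = \<sigma> s * ((fdivdiff x 0 y s - fdivdiff x 0 y (s - 1)) / a)
        + poly tt (x s) * fdivdiff x 0 y s"
      by (simp add: lower_def bdivdiff_def a_def t bdiff_def[of "fdivdiff _ _ _"])
    show ?thesis
      unfolding A L b sigma_def a_def[symmetric] using nz by (simp add: field_simps)
  qed
  then show ?thesis by (simp add: solves_def diff_eq_at_def)
qed

section \<open>Weights and the self-adjoint form\<close>

lemma pearson_step:
  assumes "s \<in> grid N"
  shows "\<sigma> (s + 1) * \<rho> (s + 1) = (\<sigma> s + tau x tt s * step 1 s) * \<rho> s"
proof -
  have "step 1 s \<noteq> 0" using assms by (rule lattice_nz)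
  then show ?thesis
    using pearson[OF assms] unfolding pearson_at_def fdivdiff_def fdiff_lattice_shift
    by (simp add: field_simps fdiff_def)
qed

lemma weight_nz: "s \<in> grid N \<Longrightarrow> weight k s \<noteq> 0"
  unfolding weight_def by (simp add: rho_nz sigma_nz)

lemma weight_0 [simp]: "weight 0 s = \<rho> s"
  by (simp add: weight_def)

lemma weight_Suc: "weight (Suc k) s = \<sigma> (s + 1) * weight k (s + 1)"
  unfolding weight_def prod.lessThan_Suc by (simp add: algebra_simps)

text \<open>
  Together with the preceding recursion this is the Pearson equation
  \<open>\<Delta>\<^sub>k\<^sub>-\<^sub>1 (\<sigma> \<rho>\<^sub>k) = \<tau>\<^sub>k \<rho>\<^sub>k\<close> of rung \<open>k\<close>. It holds because \<open>\<sigma> + \<tau>\<^sub>k \<nabla>x\<^sub>k\<^sub>+\<^sub>1\<close> is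
  \<open>\<sigma> + \<tau> \<nabla>x\<^sub>1\<close> translated by \<open>k\<close>, so that the original Pearson equation applies at \<open>s + k\<close>.
\<close>
lemma weight_pearson:
  assumes "s \<in> grid N"
  shows "weight (Suc k) s = (\<sigma> s + \<tau> k s * step (int k + 1) s) * weight k s"
proof -
  have "weight (Suc k) s
      = \<rho> (s + of_nat k + 1) * \<sigma> (s + of_nat k + 1) * (\<Prod>j<k. \<sigma> (s + of_nat k - of_nat j))"
    unfolding weight_def prod.lessThan_Suc_shift by (simp add: algebra_simps)
  then show ?thesis
    using pearson_step[of "s + of_nat k"] assms
    by (simp add: tau_seq_times_step weight_def mult.commute mult.left_commute)
qed

text \<open>
  The two expressions of \<open>\<rho>\<^sub>k\<^sub>+\<^sub>1\<close> through \<open>\<rho>\<^sub>k\<close> supply exactly the coefficients of \<open>u s\<close> and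
  \<open>u (s - 1)\<close> in \<open>L\<^sub>k u\<close>.
\<close>
lemma lower_eq_weighted_diff:
  assumes "s \<in> grid N"
  shows "weight k s * lower k u s = bdivdiff x (int k + 1) (\<lambda>t. weight (Suc k) t * u t) s"
proof -
  have nz: "step (int k + 1) s \<noteq> 0" using assms by (rule lattice_nz)
  have w: "weight (Suc k) (s - 1) = \<sigma> s * weight k s" by (simp add: weight_Suc)
  show ?thesis
    using nz unfolding bdivdiff_def lower_def bdiff_def[of u] bdiff_def[of "\<lambda>t. _ t * _ t"]
      w weight_pearson[OF assms]
    by (simp add: field_simps)
qed

section \<open>The Rodrigues formula and the general solution\<close>

text \<open>
  The \<open>k\<close> downward steps compose because the weight \<open>\<rho>\<^sub>j\<^sub>+\<^sub>1\<close> under the difference in \<open>L\<^sub>j\<close> cancels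
  against the denominator of \<open>L\<^sub>j\<^sub>+\<^sub>1\<close>. The induction adds the new step as the innermost difference
  operator.
\<close>
lemma solves_0_iff_rodrigues:
  assumes "\<And>j. j < k \<Longrightarrow> \<mu> + (\<Sum>i<j. \<kappa> i) \<noteq> 0"
  shows "solves 0 \<mu> y \<longleftrightarrow> (\<exists>u. solves k (\<mu> + (\<Sum>i<k. \<kappa> i)) u \<and>
    (\<forall>s\<in>grid N. y s = fdivdiff_iter x (- int k) k (\<lambda>t. weight k (t - of_nat k) * u (t - of_nat k)) s / \<rho> s))"
  using assms
proof (induction k)
  case 0
  show ?case
    by (auto simp: rho_nz solves_def fdivdiff_def fdiff_def lower_def bdivdiff_def bdiff_def)
next
  case (Suc k)
  let ?R = "\<lambda>k u. fdivdiff_iter x (- int k) k (\<lambda>t. weight k (t - of_nat k) * u (t - of_nat k))"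
  have R: "?R k v s = ?R (Suc k) u s"
    if vu: "\<And>s. s \<in> grid N \<Longrightarrow> v s = lower k u s" and s: "s \<in> grid N" for u v s
  proof -
    have e: "- int (Suc k) + 1 = - int k" "- int (Suc k) = - int k - 1" by simp_all
    show ?thesis
      unfolding fdivdiff_iter_Suc_right e(1) using _ s
    proof (rule fdivdiff_iter_cong)
      fix t assume t: "t \<in> grid N"
      show "weight k (t - of_nat k) * v (t - of_nat k) =
        fdivdiff x (- int (Suc k)) (\<lambda>t. weight (Suc k) (t - of_nat (Suc k)) * u (t - of_nat (Suc k))) t"
        using fdivdiff_shift[of x k "\<lambda>t. weight (Suc k) t * u t" t] t
        unfolding e(2) by (simp add: vu lower_eq_weighted_diff)
    qed
  qed
  have lower: "solves k (\<mu> + (\<Sum>i<k. \<kappa> i)) v \<longleftrightarrow>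
      (\<exists>u. solves (Suc k) (\<mu> + (\<Sum>i<Suc k. \<kappa> i)) u \<and> (\<forall>s\<in>grid N. v s = lower k u s))" for v
    using solves_iff_lower[of "\<mu> + (\<Sum>i<k. \<kappa> i)" k v] Suc.prems[of k] by (simp add: add.assoc)
  have IH: "solves 0 \<mu> y \<longleftrightarrow>
      (\<exists>v. solves k (\<mu> + (\<Sum>i<k. \<kappa> i)) v \<and> (\<forall>s\<in>grid N. y s = ?R k v s / \<rho> s))"
    using Suc by simp
  show ?case
  proof
    assume "solves 0 \<mu> y"
    then obtain v where v: "solves k (\<mu> + (\<Sum>i<k. \<kappa> i)) v" "\<forall>s\<in>grid N. y s = ?R k v s / \<rho> s"
      unfolding IH by blast
    then obtain u where u: "solves (Suc k) (\<mu> + (\<Sum>i<Suc k. \<kappa> i)) u" "\<forall>s\<in>grid N. v s = lower k u s"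
      unfolding lower by blast
    have "\<forall>s\<in>grid N. y s = ?R (Suc k) u s / \<rho> s"
    proof
      fix s assume s: "s \<in> grid N"
      have "y s = ?R k v s / \<rho> s" using v(2) s by blast
      also have "?R k v s = ?R (Suc k) u s" using u(2) s by (intro R) blast+
      finally show "y s = ?R (Suc k) u s / \<rho> s" .
    qed
    with u(1) show "\<exists>u. solves (Suc k) (\<mu> + (\<Sum>i<Suc k. \<kappa> i)) u \<and>
      (\<forall>s\<in>grid N. y s = ?R (Suc k) u s / \<rho> s)" by blast
  next
    assume "\<exists>u. solves (Suc k) (\<mu> + (\<Sum>i<Suc k. \<kappa> i)) u \<and> (\<forall>s\<in>grid N. y s = ?R (Suc k) u s / \<rho> s)"
    then obtain u where u: "solves (Suc k) (\<mu> + (\<Sum>i<Suc k. \<kappa> i)) u"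
        "\<forall>s\<in>grid N. y s = ?R (Suc k) u s / \<rho> s" by blast
    have "solves k (\<mu> + (\<Sum>i<k. \<kappa> i)) (lower k u)"
      unfolding lower using u(1) by blast
    moreover have "\<forall>s\<in>grid N. y s = ?R k (lower k u) s / \<rho> s"
    proof
      fix s assume s: "s \<in> grid N"
      have "y s = ?R (Suc k) u s / \<rho> s" using u(2) s by blast
      also have "?R (Suc k) u s = ?R k (lower k u) s" using s by (intro R[symmetric]) simp_all
      finally show "y s = ?R k (lower k u) s / \<rho> s" .
    qed
    ultimately show "solves 0 \<mu> y"
      unfolding IH by blast
  qed
qed

text \<open>
  For \<open>\<mu> = 0\<close> the self-adjoint form says that \<open>\<rho>\<^sub>n\<^sub>+\<^sub>1 \<Delta>\<^sub>n u\<close> is constant. The integrand is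
  \<open>1 / \<rho>\<^sub>n\<^sub>+\<^sub>1\<close> up to a translation by \<open>n + 1\<close>: one unit because \<open>\<nabla>\<close> of the integral is taken
  at the upper end of a step, and \<open>n\<close> because the Rodrigues formula applies its innermost
  difference to the functions \<open>\<rho>\<^sub>n\<close> and \<open>u\<close> at \<open>t - n\<close>.
\<close>
lemma solves_zero_iff:
  fixes n
  defines "I \<equiv> nabla_integral x (- int n) N (\<lambda>u. 1 / (\<rho> u * (\<Prod>j\<le>n. \<sigma> (u - of_nat j))))"
  shows "solves n 0 u \<longleftrightarrow> (\<exists>C1 C2. \<forall>s\<in>grid N. u s = C1 + C2 * I (s + of_nat n))"
proof -
  \<comment> \<open>the first integral of the equation\<close>
  let ?F = "\<lambda>s. weight (Suc n) s * fdivdiff x (int n) u s"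
  have I: "I (s + of_nat n + 1) - I (s + of_nat n) = step (int n + 2) s / weight (Suc n) s"
    if s: "s \<in> grid N" for s
  proof -
    have s': "s + of_nat n + 1 \<in> grid N" using s by simp
    have st: "step (- int n) (s + of_nat n + 1) = step (int n + 2) s"
      using bdiff_lattice_shift_add_nat[of x "- int n" s "n + 1"] by (simp add: add_ac)
    have "bdivdiff x (- int n) I (s + of_nat n + 1) = 1 / weight (Suc n) s"
      unfolding I_def bdivdiff_nabla_integral[OF s' lattice_nz[OF s']] weight_def lessThan_Suc_atMost
      by (simp add: add_ac)
    then show ?thesis
      using lattice_nz[OF s, of "int n + 2"] weight_nz[OF s, of "Suc n"]
      by (simp add: bdivdiff_def st bdiff_def[of I] divide_eq_eq)
  qed
  have S: "solves n 0 u \<longleftrightarrow> (\<forall>s\<in>grid N. ?F s = ?F (s - 1))"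
  proof -
    have "lower n (fdivdiff x (int n) u) s = 0 \<longleftrightarrow> ?F s = ?F (s - 1)" if s: "s \<in> grid N" for s
    proof -
      have "weight n s * lower n (fdivdiff x (int n) u) s = (?F s - ?F (s - 1)) / step (int n + 1) s"
        unfolding lower_eq_weighted_diff[OF s] bdivdiff_def by (simp only: bdiff_def[of ?F])
      then show ?thesis
        using lattice_nz[OF s, of "int n + 1"] weight_nz[OF s, of n]
        by (metis div_0 divide_eq_0_iff mult_eq_0_iff right_minus_eq)
    qed
    then show ?thesis by (simp add: solves_def)
  qed
  show ?thesis
  proof
    assume "solves n 0 u"
    then have F: "?F (s + 1) = ?F s" if "s \<in> grid N" for s
      using S that by (metis add_diff_cancel grid_shift(1))
    define C where "C = ?F N"
    have FC: "?F s = C" if "s \<in> grid N" for s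
      unfolding C_def using F that by (rule grid_constant)
    \<comment> \<open>subtracting the particular solution leaves a function of period one on the grid\<close>
    define h where "h = (\<lambda>s. u s - C * I (s + of_nat n))"
    have "h (s + 1) = h s" if s: "s \<in> grid N" for s
    proof -
      have "u (s + 1) - u s = C * (step (int n + 2) s / weight (Suc n) s)"
        using FC[OF s] lattice_nz[OF s, of "int n + 2"] weight_nz[OF s, of "Suc n"]
        by (simp add: fdivdiff_def fdiff_lattice_shift fdiff_def[of u] field_simps)
      then show ?thesis using I[OF s] by (simp add: h_def algebra_simps)
    qed
    then have "h s = h N" if "s \<in> grid N" for s using that by (rule grid_constant)
    then have "\<forall>s\<in>grid N. u s = h N + C * I (s + of_nat n)" by (simp add: h_def algebra_simps)
    then show "\<exists>C1 C2. \<forall>s\<in>grid N. u s = C1 + C2 * I (s + of_nat n)" by blast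
  next
    assume "\<exists>C1 C2. \<forall>s\<in>grid N. u s = C1 + C2 * I (s + of_nat n)"
    then obtain C1 C2 where u: "\<And>s. s \<in> grid N \<Longrightarrow> u s = C1 + C2 * I (s + of_nat n)" by blast
    have "?F s = C2" if s: "s \<in> grid N" for s
    proof -
      have "fdiff u s = C2 * (I (s + of_nat n + 1) - I (s + of_nat n))"
        using s by (simp add: fdiff_def u algebra_simps)
      then show ?thesis
        unfolding I[OF s] using lattice_nz[OF s, of "int n + 2"] weight_nz[OF s, of "Suc n"]
        by (simp add: fdivdiff_def fdiff_lattice_shift field_simps)
    qed
    then show "solves n 0 u" by (simp add: S)
  qed
qed

end

theorem theorem6p2:
  fixes x \<rho> :: "complex \<Rightarrow> complex" and st tt :: "complex poly"
    and N lam :: complex and n :: nat and y :: "complex \<Rightarrow> complex"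
  assumes "is_lattice x"
    and "degree st \<le> 2" and "degree tt \<le> 1"
    and "\<And>k s. s \<in> grid N \<Longrightarrow> bdiff (lattice_shift x k) s \<noteq> 0"
    and "\<And>s. s \<in> grid N \<Longrightarrow> sigma x st tt s \<noteq> 0"
    and "\<And>s. s \<in> grid N \<Longrightarrow> \<rho> s \<noteq> 0"
    and "\<And>s. s \<in> grid N \<Longrightarrow> pearson_at x st tt \<rho> s"
    and "n \<ge> 1"
    and "lam = lambda_seq x st tt N n"
    and "\<And>m. m < n \<Longrightarrow> lambda_seq x st tt N m \<noteq> lambda_seq x st tt N n"
  shows "(\<forall>s\<in>grid N. diff_eq_at x st tt lam y s) \<longleftrightarrow>
    (\<exists>C1 C2. \<forall>s\<in>grid N. y s =
        C1 / \<rho> s * fdivdiff_iter x (- int n) n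
          (\<lambda>t. \<rho> t * (\<Prod>j<n. sigma x st tt (t - of_nat j))) s
      + C2 / \<rho> s * fdivdiff_iter x (- int n) n
          (\<lambda>t. \<rho> t * (\<Prod>j<n. sigma x st tt (t - of_nat j))
             * nabla_integral x (- int n) N
                 (\<lambda>u. 1 / (\<rho> u * (\<Prod>j\<le>n. sigma x st tt (u - of_nat j)))) t) s)"
proof -
  interpret hypergeometric_grid x \<rho> st tt N
    by unfold_locales (fact assms)+
  let ?I = "nabla_integral x (- int n) N (\<lambda>u. 1 / (\<rho> u * (\<Prod>j\<le>n. \<sigma> (u - of_nat j))))"
  let ?W = "\<lambda>t. \<rho> t * (\<Prod>j<n. \<sigma> (t - of_nat j))"
  let ?D = "fdivdiff_iter x (- int n) n"
  have lam: "lambda_seq x st tt N m = - (\<Sum>i<m. \<kappa> i)" for m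
    by (simp add: lambda_seq_def \<kappa>_def)
  have "lam + (\<Sum>i<m. \<kappa> i) \<noteq> 0" if "m < n" for m
    using assms(10)[OF that] by (simp add: assms(9) lam add_eq_0_iff)
  then have "(\<forall>s\<in>grid N. diff_eq_at x st tt lam y s) \<longleftrightarrow> (\<exists>u. solves n 0 u \<and>
    (\<forall>s\<in>grid N. y s = ?D (\<lambda>t. weight n (t - of_nat n) * u (t - of_nat n)) s / \<rho> s))"
    unfolding diff_eq_iff_solves
    by (subst solves_0_iff_rodrigues[of n]) (simp_all add: assms(9) lam)
  also have "\<dots> \<longleftrightarrow> (\<exists>C1 C2. \<forall>s\<in>grid N. y s = C1 / \<rho> s * ?D ?W s + C2 / \<rho> s * ?D (\<lambda>t. ?W t * ?I t) s)"
  proof -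
    have D: "?D (\<lambda>t. weight n (t - of_nat n) * u (t - of_nat n)) s / \<rho> s
        = C1 / \<rho> s * ?D ?W s + C2 / \<rho> s * ?D (\<lambda>t. ?W t * ?I t) s"
      if u: "\<forall>s\<in>grid N. u s = C1 + C2 * ?I (s + of_nat n)" and s: "s \<in> grid N" for u C1 C2 s
    proof -
      have "?D (\<lambda>t. weight n (t - of_nat n) * u (t - of_nat n)) s = ?D (\<lambda>t. C1 * ?W t + C2 * (?W t * ?I t)) s"
        by (rule fdivdiff_iter_cong[OF _ s]) (simp add: u weight_def algebra_simps)
      then show ?thesis by (simp add: fdivdiff_iter_linear add_divide_distrib)
    qed
    show ?thesis
    proof
      assume "\<exists>u. solves n 0 u \<and>
        (\<forall>s\<in>grid N. y s = ?D (\<lambda>t. weight n (t - of_nat n) * u (t - of_nat n)) s / \<rho> s)"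
      then obtain u C1 C2 where u: "\<forall>s\<in>grid N. u s = C1 + C2 * ?I (s + of_nat n)"
        and y: "\<forall>s\<in>grid N. y s = ?D (\<lambda>t. weight n (t - of_nat n) * u (t - of_nat n)) s / \<rho> s"
        unfolding solves_zero_iff by blast
      have "\<forall>s\<in>grid N. y s = C1 / \<rho> s * ?D ?W s + C2 / \<rho> s * ?D (\<lambda>t. ?W t * ?I t) s"
        using y D[OF u] by simp
      then show "\<exists>C1 C2. \<forall>s\<in>grid N. y s = C1 / \<rho> s * ?D ?W s + C2 / \<rho> s * ?D (\<lambda>t. ?W t * ?I t) s"
        by blast
    next
      assume "\<exists>C1 C2. \<forall>s\<in>grid N. y s = C1 / \<rho> s * ?D ?W s + C2 / \<rho> s * ?D (\<lambda>t. ?W t * ?I t) s"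
      then obtain C1 C2 where
        y: "\<forall>s\<in>grid N. y s = C1 / \<rho> s * ?D ?W s + C2 / \<rho> s * ?D (\<lambda>t. ?W t * ?I t) s" by blast
      let ?u = "\<lambda>s. C1 + C2 * ?I (s + of_nat n)"
      have "solves n 0 ?u" unfolding solves_zero_iff by blast
      moreover have "\<forall>s\<in>grid N. y s = ?D (\<lambda>t. weight n (t - of_nat n) * ?u (t - of_nat n)) s / \<rho> s"
        using y D[of ?u C1 C2] by simp
      ultimately show "\<exists>u. solves n 0 u \<and>
        (\<forall>s\<in>grid N. y s = ?D (\<lambda>t. weight n (t - of_nat n) * u (t - of_nat n)) s / \<rho> s)"
        by (rule exI[of _ ?u, OF conjI])
    qed
  qed
  finally show ?thesis .
qed

end
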